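(* Let $d \ge 2$ be an integer. For every $n \in \mathbb{N}$, there is a set of $n$ points in general position in $\mathbb{R}^d$ that has at most $(d+1)^{(d+1)^2 n}$ peeling sequences.
   Context: $\mathbb{N}$ denotes the set of natural numbers. The dimension $d \ge 2$ is fixed. A set of points in $\mathbb{R}^d$ is in general position if any at most $d+1$ of its points are affinely independent. Let $P$ be a finite set of $n$ (labeled) points in $\mathbb{R}^d$ in general position. Consider the process that removes the points of $P$ one by one until no point remains, where in each step exactly one extreme point, i.e. one vertex of the convex hull of the set of currently remaining points, is removed. A peeling sequence of $P$ is a permutation $(p_1,\dots,p_n)$ of the points of $P$ obtained by listing the points in the order of their removal in such a process; i.e. for each $i$, $p_i$ is an extreme point of $\{p_i, p_{i+1},\dots,p_n\}$ (equivalently, $p_i \notin \mathrm{conv}\{p_{i+1},\dots,p_n\}$). *)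

theory Defs
  imports "HOL-Analysis.Analysis" "HOL-Combinatorics.Multiset_Permutations"
begin

definition general_position :: "(real ^ 'd) set \<Rightarrow> bool" where
  "general_position P \<longleftrightarrow>
     (\<forall>S \<subseteq> P. finite S \<and> card S \<le> CARD('d) + 1 \<longrightarrow> \<not> affine_dependent S)"

definition peeling_sequences :: "(real ^ 'd) set \<Rightarrow> (real ^ 'd) list set" where
  "peeling_sequences P =
     {ps \<in> permutations_of_set P.
        \<forall>i < length ps. (ps ! i) extreme_point_of (convex hull (set (drop i ps)))}"

text \<open>Finiteness makes \<open>card (peeling_sequences P)\<close> a genuine count, not the
  default value 0 of \<open>card\<close> on infinite sets.\<close>

lemma finite_peeling_sequences: "finite (peeling_sequences P)"
  unfolding peeling_sequences_def by simp

end

theory Submission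
  imports Defs
begin

text \<open>
  Write \<open>k = d + 1\<close>. Let \<open>v\<^sub>0, \<dots>, v\<^sub>d\<close> be the vertices of a simplex around the origin and put a copy of
  \<open>P\<close>, flattened almost to a segment, along each ray through a \<open>v\<^sub>c\<close>. While all \<open>k\<close> copies are
  nonempty, only the outermost point of each copy can be peeled. Hence the copy that is exhausted
  first is peeled in a forced order, and a peeling sequence of the union is determined by the
  sequence of copies from which points are taken, together with peeling sequences of the other \<open>d\<close>
  copies. With \<open>f(m)\<close> the number of peeling sequences of an \<open>m\<close>-point set, this gives
  \<open>f(k m) \<le> k\<^bsup>k m\<^esup> f(m)\<^bsup>d\<^esup>\<close>, so that \<open>f(m) \<le> k\<^bsup>k m\<^esup>\<close> when \<open>m\<close> is a power of \<open>k\<close>. For general \<open>n\<close>,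
  take the least power of \<open>k\<close> that is at least \<open>n\<close> (it is at most \<open>k n\<close>) and peel off the surplus.

  The bound is proved for the larger number of sequences in which no point lies in the interior of
  the convex hull of its successors. Being in the interior is an open condition, so this number
  does not grow under small perturbations, which makes general position available at no cost.
\<close>

section \<open>Removal orders under an abstract blocking relation\<close>

text \<open>Read \<open>C p S\<close> as: \<open>p\<close> is blocked while \<open>S\<close>
  remains. Keeping \<open>C\<close> abstract lets one notion of order serve points and labels
  alike.\<close>

fun avoids :: "('a \<Rightarrow> 'a set \<Rightarrow> bool) \<Rightarrow> 'a list \<Rightarrow> bool" where
  "avoids C [] \<longleftrightarrow> True"
| "avoids C (p # ps) \<longleftrightarrow> \<not> C p (set ps) \<and> avoids C ps"

definition orders :: "('a \<Rightarrow> 'a set \<Rightarrow> bool) \<Rightarrow> 'a set \<Rightarrow> 'a list set" where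
  "orders C I = {ps \<in> permutations_of_set I. avoids C ps}"

lemma finite_orders: "finite (orders C I)"
  unfolding orders_def by simp

lemma in_orders_iff: "ps \<in> orders C I \<longleftrightarrow> set ps = I \<and> distinct ps \<and> avoids C ps"
  by (auto simp: orders_def permutations_of_set_def)

lemma avoids_append_Cons: "avoids C (u @ p # v) \<Longrightarrow> \<not> C p (set v)"
  by (induction u) auto

lemma avoids_filter:
  assumes "avoids C ps" and mono: "\<And>p S T. C p S \<Longrightarrow> S \<subseteq> T \<Longrightarrow> C p T"
  shows "avoids C (filter Q ps)"
  using assms(1) by (induction ps) (auto dest: mono[of _ _ "set _"])

lemma avoids_map:
  assumes "avoids C' (map f ps)" "set ps \<subseteq> I"
    and "\<And>p S. p \<in> I \<Longrightarrow> S \<subseteq> I \<Longrightarrow> C p S \<Longrightarrow> C' (f p) (f ` S)"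
  shows "avoids C ps"
  using assms(1,2) by (induction ps) (use assms(3) in auto)

text \<open>Lists over the image pull back along \<open>f\<close>, since blocking is carried
  forward. Additional blockings among the images can only lower the count.\<close>

lemma card_orders_image_le:
  assumes fin: "finite I" and inj: "inj_on f I"
    and C: "\<And>p S. p \<in> I \<Longrightarrow> S \<subseteq> I \<Longrightarrow> C p S \<Longrightarrow> C' (f p) (f ` S)"
  shows "card (orders C' (f ` I)) \<le> card (orders C I)"
proof -
  have "orders C' (f ` I) \<subseteq> map f ` orders C I"
  proof
    fix qs assume qs: "qs \<in> orders C' (f ` I)"
    define ps where "ps = map (inv_into I f) qs"
    have *: "map f ps = qs"
      using qs unfolding ps_def map_map by (intro map_idI) (simp add: in_orders_iff f_inv_into_f)
    moreover have "set ps = I"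
      using qs inj unfolding ps_def by (auto simp: in_orders_iff image_image inv_into_f_f)
    moreover have "distinct ps"
      using qs * by (metis distinct_map in_orders_iff)
    moreover have "avoids C ps"
      using qs * \<open>set ps = I\<close> avoids_map[of C' f ps I C] C by (auto simp: in_orders_iff)
    ultimately show "qs \<in> map f ` orders C I" by (metis image_eqI in_orders_iff)
  qed
  then show ?thesis
    by (meson card_image_le card_mono finite_imageI finite_orders le_trans)
qed

lemma card_orders_remove_le:
  assumes "p \<in> I" "\<not> C p (I - {p})"
  shows "card (orders C (I - {p})) \<le> card (orders C I)"
  by (rule card_inj_on_le[of "Cons p"]) (use assms in \<open>auto simp: in_orders_iff finite_orders\<close>)

section \<open>Counting orders through colour words\<close>

text \<open>Read from the left, the colour word tells from which class the next entry is
  drawn.\<close>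

lemma list_eq_if_filters_eq:
  assumes "map g xs = map g ys" "\<And>c. filter (\<lambda>x. g x = c) xs = filter (\<lambda>x. g x = c) ys"
  shows "xs = ys"
proof -
  have "length xs = length ys" using assms(1) by (metis length_map)
  then show ?thesis using assms
  proof (induction xs ys rule: list_induct2)
    case (Cons x xs y ys)
    have "x = y" using Cons.prems(1) Cons.prems(2)[of "g x"] by simp
    moreover have "filter (\<lambda>x. g x = c) xs = filter (\<lambda>x. g x = c) ys" for c
      using Cons.prems(2)[of c] \<open>x = y\<close> by (auto split: if_splits)
    ultimately show ?case using Cons by simp
  qed simp
qed

text \<open>The witness is the letter of \<open>K\<close> whose last occurrence comes earliest: all
  others still occur after it.\<close>

lemma first_exhausted:
  assumes "K \<subseteq> set w" "K \<noteq> {}"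
  shows "\<exists>c\<in>K. \<forall>u v. w = u @ c # v \<longrightarrow> K - {c} \<subseteq> set v"
  using assms(1)
proof (induction w)
  case Nil
  then show ?case using assms(2) by simp
next
  case (Cons a w)
  show ?case
  proof (cases "K \<subseteq> set w")
    case True
    then obtain c where "c \<in> K" "\<forall>u v. w = u @ c # v \<longrightarrow> K - {c} \<subseteq> set v"
      using Cons.IH by blast
    then show ?thesis using True by (intro bexI[of _ c]) (auto simp: Cons_eq_append_conv)
  next
    case False
    then have "a \<in> K" "a \<notin> set w" "K - {a} \<subseteq> set w" using Cons.prems by auto
    then show ?thesis by (intro bexI[of _ a]) (auto simp: Cons_eq_append_conv)
  qed
qed

lemma decreasing_unique:
  fixes h :: "'a \<Rightarrow> real"
  assumes "sorted_wrt (\<lambda>x y. h y < h x) xs" "sorted_wrt (\<lambda>x y. h y < h x) ys"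
    and "set xs = set ys" "inj_on h (set xs)"
  shows "xs = ys"
proof -
  have "map (\<lambda>x. - h x) xs = map (\<lambda>x. - h x) ys"
    using assms(1-3) by (intro strict_sorted_equal) (auto simp: sorted_wrt_map)
  moreover have "inj_on (\<lambda>x. - h x) (set xs \<union> set ys)"
    using assms(3,4) by (auto simp: inj_on_def)
  ultimately show ?thesis using inj_on_map_eq_map by blast
qed

text \<open>\<open>c0 w\<close> below is the colour that is exhausted first in the word \<open>w\<close>.\<close>

lemma card_orders_coloured_le:
  fixes g :: "'a \<Rightarrow> 'c::finite" and h :: "'a \<Rightarrow> real"
  assumes fin: "finite I"
    and surj: "g ` I = UNIV"
    and inj: "\<And>c. inj_on h {p \<in> I. g p = c}"
    and mono: "\<And>p S T. C p S \<Longrightarrow> S \<subseteq> T \<Longrightarrow> C p T"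
    and cov: "\<And>p q S. \<lbrakk>p \<in> I; q \<in> S; S \<subseteq> I; g p = g q; h p < h q; - {g p} \<subseteq> g ` S\<rbrakk> \<Longrightarrow> C p S"
    and M: "\<And>c. card (orders C {p \<in> I. g p = c}) \<le> M"
  shows "card (orders C I) \<le> CARD('c) ^ card I * M ^ (CARD('c) - 1)"
proof -
  define c0 where "c0 w = (SOME c. \<forall>u v. w = u @ c # v \<longrightarrow> - {c} \<subseteq> set v)" for w :: "'c list"
  have c0: "- {c0 w} \<subseteq> set v" if "w = u @ c0 w # v" "set w = UNIV" for w u v
  proof -
    have "\<exists>c. \<forall>u v. w = u @ c # v \<longrightarrow> - {c} \<subseteq> set v"
      using first_exhausted[of UNIV w] that(2) by (auto simp: Compl_eq_Diff_UNIV)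
    from someI_ex[OF this] show ?thesis using that(1) unfolding c0_def by blast
  qed
  define part where "part ps c = filter (\<lambda>p. g p = c) ps" for ps c
  have part: "part ps c \<in> orders C {p \<in> I. g p = c}" if "ps \<in> orders C I" for ps c
    using that avoids_filter[of C ps] mono by (auto simp: part_def in_orders_iff)
  \<comment> \<open>The class exhausted first has a forced order: at each of its removals all other
    colours remain, so \<open>cov\<close> blocks a point as long as a higher one of its colour is
    present.\<close>
  have dec: "sorted_wrt (\<lambda>x y. h y < h x) (part ps (c0 (map g ps)))"
    if ps: "ps \<in> orders C I" for ps
  proof -
    define c where "c = c0 (map g ps)"
    have setg: "set (map g ps) = UNIV" using ps surj by (simp add: in_orders_iff)
    have step: "h q < h p" if "ps = u @ p # v" "g p = c" "q \<in> set v" "g q = c" for u p v q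
    proof (rule ccontr)
      assume "\<not> h q < h p"
      moreover have "h p \<noteq> h q"
        using inj[of c] that ps by (auto simp: in_orders_iff inj_on_def)
      ultimately have "h p < h q" by simp
      moreover have "- {c} \<subseteq> g ` set v"
        using c0[of "map g ps" "map g u" "map g v", folded c_def] setg that(1,2)
        by (metis list.set_map list.simps(9) map_append)
      ultimately have "C p (set v)"
        using that ps by (intro cov[of p q]) (auto simp: in_orders_iff)
      then show False using avoids_append_Cons[of C u p v] ps that by (auto simp: in_orders_iff)
    qed
    have "sorted_wrt (\<lambda>x y. h y < h x) (filter (\<lambda>p. g p = c) qs)" if "ps = u @ qs" for u qs
      using that
    proof (induction qs arbitrary: u)
      case (Cons p qs)
      then show ?case using step[of u p qs] Cons.IH[of "u @ [p]"] by auto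
    qed simp
    from this[of "[]" ps] show ?thesis unfolding part_def c_def by simp
  qed
  \<comment> \<open>Code of an order: its colour word and the orders of all classes but the forced
    one. \<open>restrict\<close> fixes the value at the omitted colour, as \<open>PiE\<close>
    requires.\<close>
  define \<Phi> where "\<Phi> ps = (map g ps, restrict (part ps) (- {c0 (map g ps)}))" for ps
  define W where "W = {w :: 'c list. set w \<subseteq> UNIV \<and> length w = card I}"
  define T where "T w = PiE (- {c0 w}) (\<lambda>c. orders C {p \<in> I. g p = c})" for w
  have finW: "finite W" unfolding W_def by (rule finite_lists_length_eq) simp
  have cardW: "card W = CARD('c) ^ card I" unfolding W_def by (rule card_lists_length_eq) simp
  have finT: "finite (T w)" for w unfolding T_def by (intro finite_PiE) (auto simp: finite_orders)
  have cardT: "card (T w) \<le> M ^ (CARD('c) - 1)" for w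
  proof -
    have "card (T w) = (\<Prod>c\<in>- {c0 w}. card (orders C {p \<in> I. g p = c}))"
      unfolding T_def by (rule card_PiE) simp
    also have "\<dots> \<le> (\<Prod>c\<in>- {c0 w}. M)" by (intro prod_mono) (use M in auto)
    also have "\<dots> = M ^ (CARD('c) - 1)" by (simp add: Compl_eq_Diff_UNIV card_Diff_singleton)
    finally show ?thesis .
  qed
  have "inj_on \<Phi> (orders C I)"
  proof (rule inj_onI)
    fix ps qs assume ps: "ps \<in> orders C I" and qs: "qs \<in> orders C I" and eq: "\<Phi> ps = \<Phi> qs"
    have g: "map g ps = map g qs" using eq by (simp add: \<Phi>_def)
    have "part ps c = part qs c" for c
    proof (cases "c = c0 (map g ps)")
      case True
      then show ?thesis
        using dec[OF ps] dec[OF qs] g inj[of c] ps qs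
        by (intro decreasing_unique[of h]) (auto simp: part_def in_orders_iff)
    next
      case False
      then show ?thesis using eq g unfolding \<Phi>_def
        by (metis (mono_tags, lifting) ComplI prod.inject restrict_apply' singletonD)
    qed
    then show "ps = qs" using g list_eq_if_filters_eq[of g ps qs] unfolding part_def by blast
  qed
  moreover have "\<Phi> ` orders C I \<subseteq> Sigma W T"
    using part by (auto simp: \<Phi>_def W_def T_def in_orders_iff[of _ C I] distinct_card[symmetric])
  ultimately have "card (orders C I) \<le> card (Sigma W T)"
    using finW finT by (intro card_inj_on_le) auto
  also have "\<dots> = (\<Sum>w\<in>W. card (T w))" using finW finT by simp
  also have "\<dots> \<le> (\<Sum>w\<in>W. M ^ (CARD('c) - 1))" by (intro sum_mono cardT)
  also have "\<dots> = CARD('c) ^ card I * M ^ (CARD('c) - 1)" by (simp add: cardW)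
  finally show ?thesis .
qed

section \<open>Stability of interiors and general position\<close>

text \<open>A hyperplane with normal \<open>a\<close> separating \<open>y'\<close> from the perturbed hull would, moved by \<open>\<eta>\<close> against
  \<open>a\<close>, separate from the original hull a point closer than \<open>2 \<eta>\<close> to \<open>y\<close>.\<close>

lemma perturbed_mem_convex_hull:
  fixes f f' :: "'a \<Rightarrow> 'n::euclidean_space"
  assumes S: "finite S" "S \<noteq> {}"
    and ball: "ball y (2 * \<eta>) \<subseteq> convex hull (f ` S)"
    and y': "dist y' y < \<eta>"
    and f': "\<And>s. s \<in> S \<Longrightarrow> dist (f' s) (f s) < \<eta>"
  shows "y' \<in> convex hull (f' ` S)"
proof (rule ccontr)
  assume "y' \<notin> convex hull (f' ` S)"
  moreover have "closed (convex hull (f' ` S))"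
    using S by (intro compact_imp_closed compact_convex_hull finite_imp_compact) simp
  ultimately obtain a b where ab: "inner a y' < b" "\<And>x. x \<in> convex hull (f' ` S) \<Longrightarrow> b < inner a x"
    using separating_hyperplane_closed_point[of "convex hull (f' ` S)" y'] by auto
  obtain s0 where "s0 \<in> S" using S by blast
  then have "a \<noteq> 0" using ab(1) ab(2)[of "f' s0"] by (auto simp: hull_inc)
  have \<eta>: "\<eta> > 0" using y' by (smt (verit) zero_le_dist)
  define z where "z = y' - (\<eta> / norm a) *\<^sub>R a"
  have "dist z y < 2 * \<eta>"
  proof -
    have "dist z y' = \<eta>" using \<open>a \<noteq> 0\<close> \<eta> by (simp add: z_def dist_norm)
    then show ?thesis using y' dist_triangle[of z y y'] by simp
  qed
  then have "z \<in> convex hull (f ` S)" using ball by (auto simp: dist_commute)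
  moreover have "convex hull (f ` S) \<subseteq> {x. inner a z < inner a x}"
  proof (rule hull_minimal)
    show "f ` S \<subseteq> {x. inner a z < inner a x}"
    proof clarify
      fix s assume s: "s \<in> S"
      have "inner a (f' s - f s) \<le> norm a * norm (f' s - f s)" by (rule norm_cauchy_schwarz)
      also have "\<dots> < norm a * \<eta>" using f'[OF s] \<open>a \<noteq> 0\<close> by (simp add: dist_norm)
      finally have "inner a (f' s) - inner a (f s) < norm a * \<eta>" by (simp add: inner_diff_right)
      moreover have "b < inner a (f' s)" using s by (intro ab(2) hull_inc) auto
      moreover have "inner a z = inner a y' - norm a * \<eta>"
        using \<open>a \<noteq> 0\<close> by (simp add: z_def inner_diff_right dot_square_norm power2_eq_square)
      ultimately show "inner a z < inner a (f s)" using ab(1) by simp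
    qed
    show "convex {x. inner a z < inner a x}" using convex_halfspace_gt[of "inner a z" a] by simp
  qed
  ultimately show False by auto
qed

lemma perturbed_mem_interior_convex_hull:
  fixes f :: "'a \<Rightarrow> 'n::euclidean_space"
  assumes "finite S" "y \<in> interior (convex hull (f ` S))"
  shows "\<exists>\<eta>>0. \<forall>y' f'. dist y' y < \<eta> \<longrightarrow> (\<forall>s\<in>S. dist (f' s) (f s) < \<eta>) \<longrightarrow>
           y' \<in> interior (convex hull (f' ` S))"
proof -
  obtain e where e: "e > 0" "ball y e \<subseteq> convex hull (f ` S)"
    using assms(2) by (auto simp: mem_interior)
  have "S \<noteq> {}" using assms(2) by auto
  \<comment> \<open>A point within \<open>e / 4\<close> of \<open>y'\<close> is within
    \<open>e / 2\<close> of \<open>y\<close>, and the radius \<open>2 * (e / 2) = e\<close> is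
    available.\<close>
  have "y' \<in> interior (convex hull (f' ` S))"
    if "dist y' y < e / 4" "\<forall>s\<in>S. dist (f' s) (f s) < e / 4" for y' f'
    unfolding mem_interior
  proof (intro exI conjI)
    show "e / 4 > 0" using e by simp
    show "ball y' (e / 4) \<subseteq> convex hull (f' ` S)"
    proof
      fix x assume "x \<in> ball y' (e / 4)"
      then have "dist x y < e / 2"
        using that(1) dist_triangle[of x y y'] by (simp add: dist_commute)
      then show "x \<in> convex hull (f' ` S)"
        using that(2) e \<open>S \<noteq> {}\<close> assms(1)
        by (intro perturbed_mem_convex_hull[of S y "e / 2" f]) force+
    qed
  qed
  then show ?thesis using e by (intro exI[of _ "e / 4"]) auto
qed

text \<open>Only finitely many pairs \<open>(p, S)\<close> have to survive, so the least of their
  tolerances works for all.\<close>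

lemma interior_convex_hull_stable:
  fixes f :: "'a \<Rightarrow> 'n::euclidean_space"
  assumes "finite I"
  obtains \<eta> where "\<eta> > 0"
    "\<And>f' p S. \<lbrakk>\<And>i. i \<in> I \<Longrightarrow> dist (f' i) (f i) < \<eta>; p \<in> I; S \<subseteq> I; f p \<in> interior (convex hull (f ` S))\<rbrakk>
       \<Longrightarrow> f' p \<in> interior (convex hull (f' ` S))"
proof -
  define D where "D = {(p, S). p \<in> I \<and> S \<subseteq> I \<and> f p \<in> interior (convex hull (f ` S))}"
  have "finite D"
    by (rule finite_subset[of _ "I \<times> Pow I"]) (use assms in \<open>auto simp: D_def\<close>)
  have "\<forall>d\<in>D. \<exists>\<eta>>0. \<forall>y' f'. dist y' (f (fst d)) < \<eta> \<longrightarrow> (\<forall>s\<in>snd d. dist (f' s) (f s) < \<eta>) \<longrightarrow>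
           y' \<in> interior (convex hull (f' ` snd d))"
  proof
    fix d assume "d \<in> D"
    then have "finite (snd d)" "f (fst d) \<in> interior (convex hull (f ` snd d))"
      using assms finite_subset by (auto simp: D_def)
    then show "\<exists>\<eta>>0. \<forall>y' f'. dist y' (f (fst d)) < \<eta> \<longrightarrow>
        (\<forall>s\<in>snd d. dist (f' s) (f s) < \<eta>) \<longrightarrow> y' \<in> interior (convex hull (f' ` snd d))"
      by (rule perturbed_mem_interior_convex_hull)
  qed
  then obtain \<eta> where \<eta>: "\<And>d. d \<in> D \<Longrightarrow> \<eta> d > 0"
    "\<And>d y' f'. \<lbrakk>d \<in> D; dist y' (f (fst d)) < \<eta> d; \<And>s. s \<in> snd d \<Longrightarrow> dist (f' s) (f s) < \<eta> d\<rbrakk>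
       \<Longrightarrow> y' \<in> interior (convex hull (f' ` snd d))"
    by metis
  define m where "m = Min (insert 1 (\<eta> ` D))"
  have m: "m > 0" "\<And>d. d \<in> D \<Longrightarrow> m \<le> \<eta> d"
    using \<open>finite D\<close> \<eta>(1) by (auto simp: m_def)
  show thesis
  proof (rule that[OF m(1)])
    fix f' p S
    assume *: "\<And>i. i \<in> I \<Longrightarrow> dist (f' i) (f i) < m" "p \<in> I" "S \<subseteq> I"
      "f p \<in> interior (convex hull (f ` S))"
    then have "(p, S) \<in> D" by (simp add: D_def)
    from \<eta>(2)[OF this, of "f' p" f'] m(2)[OF this] show "f' p \<in> interior (convex hull (f' ` S))"
      using * by force
  qed
qed

text \<open>Points are moved one by one; the forbidden places for each form a null set, which cannot
  fill a ball. Distinct values of \<open>inner w\<close> are secured for the next round of the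
  construction.\<close>

lemma perturb_general_position:
  fixes f :: "'a \<Rightarrow> real ^ 'd"
  assumes "finite I" "\<eta> > 0" "w \<noteq> 0"
  shows "\<exists>f'. (\<forall>i\<in>I. dist (f' i) (f i) < \<eta>) \<and> general_position (f' ` I) \<and>
           inj_on (\<lambda>i. inner w (f' i)) I"
  using assms(1)
proof induction
  case empty
  then show ?case by (auto simp: general_position_def)
next
  case (insert a I)
  then obtain f' where f': "\<forall>i\<in>I. dist (f' i) (f i) < \<eta>" "general_position (f' ` I)"
    "inj_on (\<lambda>i. inner w (f' i)) I" by blast
  define B where "B = (\<Union>S\<in>{S. S \<subseteq> f' ` I \<and> card S \<le> CARD('d)}. affine hull S)
    \<union> (\<Union>i\<in>I. {x. inner w x = inner w (f' i)})"
  have neg_hull: "negligible (affine hull S)" if "S \<subseteq> f' ` I" "card S \<le> CARD('d)" for S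
  proof -
    have "finite S" using that insert.hyps finite_subset by blast
    have "aff_dim (affine hull S) < DIM(real ^ 'd)"
      using aff_dim_le_card[OF \<open>finite S\<close>] that by simp
    then obtain c b where "c \<noteq> 0" "affine hull S \<subseteq> {x. inner c x = b}"
      using aff_lowdim_subset_hyperplane by blast
    then show ?thesis using negligible_hyperplane negligible_subset by blast
  qed
  have "negligible B"
    unfolding B_def using insert.hyps neg_hull \<open>w \<noteq> 0\<close>
    by (intro negligible_Un negligible_Union) (auto intro: negligible_hyperplane)
  moreover have "\<not> negligible (ball (f a) \<eta>)"
    using \<open>\<eta> > 0\<close> by (intro open_not_negligible) auto
  ultimately have "\<not> ball (f a) \<eta> \<subseteq> B" using negligible_subset by blast
  then obtain y where y: "dist y (f a) < \<eta>" "y \<notin> B" by (metis dist_commute mem_ball subsetI)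
  define g where "g = f'(a := y)"
  have g: "g ` insert a I = insert y (f' ` I)" "\<And>i. i \<in> I \<Longrightarrow> g i = f' i" "g a = y"
    using insert.hyps unfolding g_def by auto
  have "general_position (insert y (f' ` I))"
    unfolding general_position_def
  proof (intro allI impI, elim conjE)
    fix S assume S: "S \<subseteq> insert y (f' ` I)" "finite S" "card S \<le> CARD('d) + 1"
    show "\<not> affine_dependent S"
    proof (cases "y \<in> S")
      case True
      have sub: "S - {y} \<subseteq> f' ` I" "card (S - {y}) \<le> CARD('d)" using S True by auto
      then have "y \<notin> affine hull (S - {y})" using y(2) unfolding B_def by blast
      moreover have "\<not> affine_dependent (S - {y})"
        using f'(2) sub S unfolding general_position_def by auto
      ultimately show ?thesis using affine_independent_insert True by (metis insert_Diff)
    next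
      case False
      then show ?thesis using S f'(2) unfolding general_position_def by auto
    qed
  qed
  moreover have "inj_on (\<lambda>i. inner w (g i)) (insert a I)"
    using f'(3) y(2) insert.hyps g unfolding B_def inj_on_def by force
  ultimately show ?case using f'(1) y(1) g by (intro exI[of _ g]) auto
qed

section \<open>A simplex around the origin\<close>

text \<open>\<open>'d option\<close> has exactly d + 1 elements, so it indexes the simplex vertices
  and later the colours. \<open>None\<close> gets the vector that makes the sum vanish.\<close>

definition vertex :: "'d option \<Rightarrow> real ^ 'd::finite" where
  "vertex c = (case c of None \<Rightarrow> - (\<Sum>i\<in>UNIV. axis i 1) | Some i \<Rightarrow> axis i 1)"

lemma sum_vertex: "(\<Sum>c\<in>UNIV. vertex c) = 0"
  by (simp add: UNIV_option_conv sum.reindex vertex_def)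

text \<open>Otherwise some nonzero normal has nonnegative inner products with all vertices. These
  sum to 0, so all vanish, and the unit vectors among the vertices force the normal to be 0.\<close>

lemma zero_in_interior_simplex:
  fixes a :: "'d::finite option \<Rightarrow> real"
  assumes a: "\<And>c. a c > 0"
  shows "0 \<in> interior (convex hull (range (\<lambda>c. a c *\<^sub>R vertex c)))"
proof (rule ccontr)
  define K where "K = convex hull (range (\<lambda>c. a c *\<^sub>R (vertex c :: real ^ 'd)))"
  assume "0 \<notin> interior (convex hull (range (\<lambda>c. a c *\<^sub>R (vertex c :: real ^ 'd))))"
  then have not0: "0 \<notin> interior K" by (simp add: K_def)
  have "\<exists>w. w \<noteq> 0 \<and> (\<forall>x\<in>K. 0 \<le> inner w x)"
  proof (cases "interior K = {}")
    case True
    then obtain w b where "w \<noteq> 0" "K \<subseteq> {x. inner w x = b}"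
      using empty_interior_subset_hyperplane[of K] by (auto simp: K_def)
    then show ?thesis
      by (intro exI[of _ "if b \<ge> 0 then w else - w"]) auto
  next
    case False
    obtain w where w: "w \<noteq> 0" "\<forall>x\<in>interior K. 0 \<le> inner w x"
      using separating_hyperplane_set_0[of "interior K"] not0 by (auto simp: K_def convex_interior)
    have "closure (interior K) \<subseteq> {x. inner w x \<ge> 0}"
      using w(2) by (intro closure_minimal) (auto intro: closed_halfspace_ge)
    moreover have "K \<subseteq> closure (interior K)"
      using False convex_closure_interior[of K] closure_subset[of K] by (simp add: K_def)
    ultimately show ?thesis using w(1) by blast
  qed
  then obtain w where w: "w \<noteq> 0" "\<And>x. x \<in> K \<Longrightarrow> 0 \<le> inner w x" by blast
  have pos: "0 \<le> inner w (vertex c)" for c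
    using w(2)[of "a c *\<^sub>R vertex c"] a[of c] by (simp add: K_def hull_inc zero_le_mult_iff)
  have "(\<Sum>c\<in>UNIV. inner w (vertex c)) = 0"
    by (simp add: inner_sum_right[symmetric] sum_vertex)
  then have "inner w (vertex c) = 0" for c
    using sum_nonneg_eq_0_iff[of UNIV "\<lambda>c. inner w (vertex c)"] pos by simp
  from this[of "Some _"] have "w = 0" by (simp add: vertex_def vec_eq_iff inner_axis)
  with w(1) show False by contradiction
qed

text \<open>Shrinking a hull point towards the interior point 0 lands in the interior. Thus a
  farther point on the same ray, with one point on every other ray, blocks a nearer one.\<close>

lemma shrunk_vertex_in_interior:
  fixes a :: "'d::finite option \<Rightarrow> real"
  assumes a: "\<And>c. a c > 0" and r: "0 < r" "r < a c"
  shows "r *\<^sub>R vertex c \<in> interior (convex hull (range (\<lambda>c. a c *\<^sub>R vertex c)))"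
proof -
  have "a c *\<^sub>R vertex c - (1 - r / a c) *\<^sub>R (a c *\<^sub>R vertex c - 0)
      \<in> interior (convex hull (range (\<lambda>c. a c *\<^sub>R (vertex c :: real ^ 'd))))"
    using r a by (intro mem_interior_convex_shrink zero_in_interior_simplex)
      (auto simp: hull_inc field_simps)
  moreover have "a c *\<^sub>R vertex c - (1 - r / a c) *\<^sub>R (a c *\<^sub>R vertex c - 0) = r *\<^sub>R (vertex c :: real ^ 'd)"
  proof -
    have "a c - (1 - r / a c) * a c = r" using a[of c] by (simp add: field_simps)
    then show ?thesis by (metis diff_zero scaleR_diff_left scaleR_scaleR)
  qed
  ultimately show ?thesis by simp
qed

section \<open>Replacing a set by d + 1 flattened copies\<close>

text \<open>Positions enter through \<open>f\<close>, so they can be perturbed while the labels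
  being ordered stay fixed.\<close>

definition surrounded :: "('a \<Rightarrow> 'n::euclidean_space) \<Rightarrow> 'a \<Rightarrow> 'a set \<Rightarrow> bool" where
  "surrounded f p S \<longleftrightarrow> f p \<in> interior (convex hull (f ` S))"

lemma surrounded_mono: "surrounded f p S \<Longrightarrow> S \<subseteq> T \<Longrightarrow> surrounded f p T"
  unfolding surrounded_def by (meson hull_mono image_mono interior_mono subsetD)

abbreviation enclosed :: "'n::euclidean_space \<Rightarrow> 'n set \<Rightarrow> bool" where
  "enclosed \<equiv> surrounded (\<lambda>x. x)"

text \<open>The heights \<open>inner w\<close> order the points along the rays. Their injectivity
  makes the order in the copy exhausted first unique; it is asserted of \<open>Q\<close> so that the
  step can be repeated.\<close>

lemma peeling_step:
  fixes P :: "(real ^ 'd::finite) set"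
  assumes P: "finite P" "P \<noteq> {}" "inj_on (inner w) P" and "w \<noteq> 0"
  obtains Q :: "(real ^ 'd) set" where "finite Q" "card Q = card P * (CARD('d) + 1)"
    "general_position Q" "inj_on (inner w) Q"
    "card (orders enclosed Q)
       \<le> (CARD('d) + 1) ^ card Q * card (orders enclosed P) ^ CARD('d)"
proof -
  \<comment> \<open>The shift makes all heights at least 1, so that every point has a positive
    coefficient on its ray.\<close>
  define t where "t = 1 - Min (inner w ` P)"
  have t: "t + inner w p > 0" if "p \<in> P" for p
  proof -
    have "Min (inner w ` P) \<le> inner w p" using P that by (intro Min_le) auto
    then show ?thesis by (simp add: t_def)
  qed
  define I where "I = P \<times> (UNIV :: 'd option set)"
  have finI: "finite I" using P by (simp add: I_def)
  \<comment> \<open>For \<open>\<epsilon> = 0\<close> the copies are collinear and the covering condition is strict; for small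
    \<open>\<epsilon> > 0\<close> it persists, and each copy is a nonsingular affine image of \<open>P\<close>.\<close>
  define \<phi> where "\<phi> \<epsilon> i = (t + inner w (fst i)) *\<^sub>R vertex (snd i) + \<epsilon> *\<^sub>R fst i"
    for \<epsilon> and i :: "(real ^ 'd) \<times> 'd option"
  obtain \<eta> where "\<eta> > 0" and \<eta>: "\<And>f' p S. \<lbrakk>\<And>i. i \<in> I \<Longrightarrow> dist (f' i) (\<phi> 0 i) < \<eta>; p \<in> I; S \<subseteq> I;
      \<phi> 0 p \<in> interior (convex hull (\<phi> 0 ` S))\<rbrakk> \<Longrightarrow> f' p \<in> interior (convex hull (f' ` S))"
    using interior_convex_hull_stable[OF finI, of "\<phi> 0"] by blast
  define m where "m = Max (norm ` P)"
  have m: "norm p \<le> m" if "p \<in> P" for p using P that by (simp add: m_def)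
  have "m \<ge> 0" using P(2) m norm_ge_zero order_trans by blast
  \<comment> \<open>Flattened copies may deviate by less than \<open>\<eta> / 2\<close>, the rest
    being reserved for \<open>\<psi>\<close>; \<open>m + 1\<close> avoids division by 0.\<close>
  define u where "u = \<eta> / 2 / (m + 1)"
  have "u > 0" using \<open>\<eta> > 0\<close> \<open>m \<ge> 0\<close> by (simp add: u_def)
  \<comment> \<open>The finitely many excluded values are those at which the linear part of some
    copy is singular.\<close>
  then have "infinite ({0<..<u} - range (\<lambda>c. - inner w (vertex c)))"
    by (intro Diff_infinite_finite) (auto simp: infinite_Ioo)
  from infinite_imp_nonempty[OF this]
  obtain \<epsilon> where "\<epsilon> \<in> {0<..<u} - range (\<lambda>c. - inner w (vertex c))" by blast
  then have \<epsilon>: "0 < \<epsilon>" "\<epsilon> < u" "\<epsilon> \<noteq> - inner w (vertex c)" for c by auto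
  have near: "dist (\<phi> \<epsilon> i) (\<phi> 0 i) < \<eta> / 2" if "i \<in> I" for i
  proof -
    have "\<epsilon> * norm (fst i) \<le> \<epsilon> * m" using m[of "fst i"] that \<epsilon> by (auto simp: I_def)
    also have "\<dots> \<le> u * m" using \<epsilon> \<open>m \<ge> 0\<close> by (intro mult_right_mono) auto
    also have "\<dots> < u * (m + 1)" using \<open>u > 0\<close> by simp
    also have "\<dots> = \<eta> / 2"
      by (rule iffD1[OF nonzero_eq_divide_eq]) (use \<open>m \<ge> 0\<close> in \<open>simp_all add: u_def\<close>)
    finally show ?thesis using \<epsilon> by (simp add: \<phi>_def dist_norm)
  qed
  \<comment> \<open>\<open>\<eta>\<close> protects blocking across copies, seen at parameter 0;
    \<open>\<eta>'\<close> protects blocking inside each copy at the chosen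
    \<open>\<epsilon>\<close>. The map \<open>\<psi>\<close> respects both.\<close>
  obtain \<eta>' where "\<eta>' > 0" and \<eta>': "\<And>f' p S. \<lbrakk>\<And>i. i \<in> I \<Longrightarrow> dist (f' i) (\<phi> \<epsilon> i) < \<eta>'; p \<in> I; S \<subseteq> I;
      \<phi> \<epsilon> p \<in> interior (convex hull (\<phi> \<epsilon> ` S))\<rbrakk> \<Longrightarrow> f' p \<in> interior (convex hull (f' ` S))"
    using interior_convex_hull_stable[OF finI, of "\<phi> \<epsilon>"] by blast
  obtain \<psi> where \<psi>: "\<And>i. i \<in> I \<Longrightarrow> dist (\<psi> i) (\<phi> \<epsilon> i) < min \<eta>' (\<eta> / 2)"
    "general_position (\<psi> ` I)" "inj_on (\<lambda>i. inner w (\<psi> i)) I"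
    using perturb_general_position[of I "min \<eta>' (\<eta> / 2)" w "\<phi> \<epsilon>"] finI \<open>\<eta> > 0\<close> \<open>\<eta>' > 0\<close> \<open>w \<noteq> 0\<close>
    by auto
  have \<psi>0: "dist (\<psi> i) (\<phi> 0 i) < \<eta>" if "i \<in> I" for i
    using \<psi>(1)[OF that] near[OF that] dist_triangle[of "\<psi> i" "\<phi> 0 i" "\<phi> \<epsilon> i"] by linarith
  have cov: "surrounded \<psi> i S" if i: "i \<in> I" "j \<in> S" "S \<subseteq> I" "snd i = snd j"
    "inner w (fst i) < inner w (fst j)" "- {snd i} \<subseteq> snd ` S" for i j S
  proof -
    have "\<forall>c. \<exists>s\<in>S. snd s = c" using i(2,4,6) by (metis ComplI imageE singletonD subsetD)
    then obtain s0 where s0: "\<And>c. s0 c \<in> S" "\<And>c. snd (s0 c) = c" by metis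
    \<comment> \<open>In the colour of \<open>i\<close> the representative is \<open>j\<close>, so
      the simplex reaches beyond \<open>i\<close> along its ray.\<close>
    define s where "s = s0(snd i := j)"
    have s: "s c \<in> S" "snd (s c) = c" for c using s0 i by (auto simp: s_def)
    have "(t + inner w (fst i)) *\<^sub>R vertex (snd i) \<in>
        interior (convex hull (range (\<lambda>c. (t + inner w (fst (s c))) *\<^sub>R vertex c)))"
    proof (rule shrunk_vertex_in_interior)
      show "t + inner w (fst (s c)) > 0" for c
        using s[of c] i(3) by (intro t) (auto simp: I_def)
      show "t + inner w (fst i) > 0" using i(1) by (intro t) (auto simp: I_def)
      show "t + inner w (fst i) < t + inner w (fst (s (snd i)))" using i by (simp add: s_def)
    qed
    moreover have "range (\<lambda>c. (t + inner w (fst (s c))) *\<^sub>R vertex c) \<subseteq> \<phi> 0 ` S"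
    proof clarify
      fix c show "(t + inner w (fst (s c))) *\<^sub>R vertex c \<in> \<phi> 0 ` S"
        using s[of c] by (intro image_eqI[of _ _ "s c"]) (simp_all add: \<phi>_def)
    qed
    ultimately have "(t + inner w (fst i)) *\<^sub>R vertex (snd i) \<in> interior (convex hull (\<phi> 0 ` S))"
      by (meson hull_mono interior_mono subsetD)
    then have "\<phi> 0 i \<in> interior (convex hull (\<phi> 0 ` S))" by (simp add: \<phi>_def)
    then show ?thesis unfolding surrounded_def using \<eta>[of \<psi> i S] \<psi>0 i by blast
  qed
  have group: "surrounded \<psi> (p, c) ((\<lambda>p. (p, c)) ` S)"
    if p: "p \<in> P" "S \<subseteq> P" "enclosed p S" for p c S
  proof -
    define T where "T x = inner w x *\<^sub>R vertex c + \<epsilon> *\<^sub>R x" for x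
    have lin: "linear T"
      by (rule linearI) (simp_all add: T_def inner_add_right scaleR_add_left scaleR_add_right)
    have "x = 0" if "T x = 0" for x
    proof -
      have x: "\<epsilon> *\<^sub>R x = - inner w x *\<^sub>R vertex c" using that by (simp add: T_def eq_neg_iff_add_eq_0 add.commute)
      then have "inner w (\<epsilon> *\<^sub>R x) = - inner w x * inner w (vertex c)" by simp
      then have "inner w x * (\<epsilon> + inner w (vertex c)) = 0" by (simp add: algebra_simps)
      then have "inner w x = 0" using \<epsilon>(3)[of c] by (simp add: eq_neg_iff_add_eq_0)
      then show ?thesis using x \<epsilon>(1) by simp
    qed
    then have inj: "inj T" using lin by (simp add: linear_injective_0)
    have im: "\<phi> \<epsilon> ` (\<lambda>p. (p, c)) ` S = (+) (t *\<^sub>R vertex c) ` T ` S"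
      unfolding image_image by (simp add: \<phi>_def T_def scaleR_add_left add.assoc)
    have "\<phi> \<epsilon> (p, c) = t *\<^sub>R vertex c + T p" by (simp add: \<phi>_def T_def scaleR_add_left add.assoc)
    moreover have "p \<in> interior (convex hull S)" using p(3) by (simp add: surrounded_def)
    ultimately have "\<phi> \<epsilon> (p, c) \<in> interior (convex hull (\<phi> \<epsilon> ` (\<lambda>p. (p, c)) ` S))"
      unfolding im convex_hull_translation convex_hull_linear_image[OF lin, symmetric]
        interior_translation interior_injective_linear_image[OF lin inj] by blast
    moreover have "(p, c) \<in> I" "(\<lambda>p. (p, c)) ` S \<subseteq> I" using p by (auto simp: I_def)
    moreover have "dist (\<psi> i) (\<phi> \<epsilon> i) < \<eta>'" if "i \<in> I" for i using \<psi>(1)[OF that] by simp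
    ultimately show ?thesis unfolding surrounded_def
      using \<eta>'[of \<psi> "(p, c)" "(\<lambda>p. (p, c)) ` S"] by blast
  qed
  have inj\<psi>: "inj_on \<psi> I" using \<psi>(3) by (auto simp: inj_on_def)
  have cardU: "CARD('d option) = CARD('d) + 1" by simp
  have "card (orders enclosed (\<psi> ` I)) \<le> card (orders (surrounded \<psi>) I)"
    by (rule card_orders_image_le[OF finI inj\<psi>]) (simp add: surrounded_def)
  also have "\<dots> \<le> CARD('d option) ^ card I * card (orders enclosed P) ^ (CARD('d option) - 1)"
  proof (rule card_orders_coloured_le[where g = snd and h = "\<lambda>i. inner w (fst i)"])
    show "finite I" by (rule finI)
    show "snd ` I = UNIV" using P(2) by (force simp: I_def)
    show "inj_on (\<lambda>i. inner w (fst i)) {p \<in> I. snd p = c}" for c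
      using P(3) by (auto simp: I_def inj_on_def)
    show "surrounded \<psi> p S \<Longrightarrow> S \<subseteq> T \<Longrightarrow> surrounded \<psi> p T" for p S T by (rule surrounded_mono)
    show "card (orders (surrounded \<psi>) {p \<in> I. snd p = c}) \<le> card (orders enclosed P)" for c
    proof -
      have "{p \<in> I. snd p = c} = (\<lambda>p. (p, c)) ` P" by (auto simp: I_def)
      then show ?thesis
        using card_orders_image_le[of P "\<lambda>p. (p, c)" "enclosed" "surrounded \<psi>"] P(1) group
        by (simp add: inj_on_def)
    qed
  qed (rule cov)
  finally have bound: "card (orders enclosed (\<psi> ` I))
       \<le> (CARD('d) + 1) ^ card (\<psi> ` I) * card (orders enclosed P) ^ CARD('d)"
    unfolding cardU using card_image[OF inj\<psi>] by simp
  show thesis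
  proof (rule that[of "\<psi> ` I"])
    show "card (\<psi> ` I) = card P * (CARD('d) + 1)"
      using card_image[OF inj\<psi>] by (simp add: I_def card_cartesian_product)
    show "inj_on (inner w) (\<psi> ` I)" using \<psi>(3) by (auto simp: inj_on_def)
  qed (use finI \<psi>(2) bound in auto)
qed

section \<open>Powers of d + 1 and general n\<close>

text \<open>With k = d + 1, the exponent k m reproduces itself: at the new size m' = k m, the words
  contribute m' and the d recorded copies d k m = d m', in total k m'.\<close>

lemma few_peelings_power:
  assumes "w \<noteq> 0"
  shows "\<exists>P :: (real ^ 'd::finite) set. finite P \<and> card P = (CARD('d) + 1) ^ j \<and>
           general_position P \<and> inj_on (inner w) P \<and>
           card (orders enclosed P) \<le> (CARD('d) + 1) ^ ((CARD('d) + 1) * (CARD('d) + 1) ^ j)"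
proof (induction j)
  case 0
  have "card (orders enclosed {0 :: real ^ 'd}) \<le> card (permutations_of_set {0 :: real ^ 'd})"
    by (intro card_mono) (auto simp: orders_def)
  also have "\<dots> \<le> (CARD('d) + 1) ^ ((CARD('d) + 1) * (CARD('d) + 1) ^ 0)"
    by (simp del: power_Suc)
  finally have bound: "card (orders enclosed {0 :: real ^ 'd}) \<le> \<dots>" .
  have "general_position {0 :: real ^ 'd}"
    by (auto simp: general_position_def subset_singleton_iff)
  then show ?case by (intro exI[of _ "{0}"] conjI bound) auto
next
  case (Suc j)
  define k where "k = CARD('d) + 1"
  obtain P :: "(real ^ 'd) set" where P: "finite P" "card P = k ^ j" "inj_on (inner w) P"
    "card (orders enclosed P) \<le> k ^ (k * k ^ j)"
    using Suc by (auto simp: k_def)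
  have "card P \<noteq> 0" unfolding P(2) k_def by simp
  then have "P \<noteq> {}" by auto
  from peeling_step[OF P(1) this P(3) assms]
  obtain Q :: "(real ^ 'd) set" where Q: "finite Q" "card Q = card P * k" "general_position Q"
    "inj_on (inner w) Q"
    "card (orders enclosed Q) \<le> k ^ card Q * card (orders enclosed P) ^ CARD('d)"
    unfolding k_def by blast
  note Q(5)
  also have "k ^ card Q * card (orders enclosed P) ^ CARD('d)
      \<le> k ^ card Q * (k ^ (k * k ^ j)) ^ CARD('d)"
    by (intro mult_left_mono power_mono P(4)) auto
  also have "\<dots> = k ^ (k ^ Suc j + k ^ Suc j * CARD('d))"
    by (simp add: Q(2) P(2) power_add[symmetric] power_mult[symmetric] mult_ac)
  also have "k ^ Suc j + k ^ Suc j * CARD('d) = k * k ^ Suc j" by (simp add: k_def)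
  finally show ?case using Q P(2) unfolding k_def by (intro exI[of _ Q]) (auto simp: mult.commute)
qed

text \<open>\<open>S\<close> lies in a half-space with \<open>p\<close> on its boundary, so the
  interior of its hull lies strictly below \<open>p\<close>.\<close>

lemma maximal_not_surrounded:
  fixes p :: "'n::euclidean_space"
  assumes "w \<noteq> 0" "\<And>q. q \<in> S \<Longrightarrow> inner w q \<le> inner w p"
  shows "\<not> enclosed p S"
proof -
  have "convex hull S \<subseteq> {x. inner w x \<le> inner w p}"
    using assms(2) by (intro hull_minimal) (auto intro: convex_halfspace_le)
  then have "interior (convex hull S) \<subseteq> {x. inner w x < inner w p}"
    using interior_mono interior_halfspace_le[OF assms(1)] by metis
  then show ?thesis by (auto simp: surrounded_def)
qed

text \<open>A point of maximal height is never enclosed by the others, so it can be put in front of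
  every order of the rest. Deleting such points one by one never raises the count.\<close>

lemma few_peelings_subset:
  fixes P :: "'n::euclidean_space set"
  assumes "finite P" "n \<le> card P"
  shows "\<exists>Q\<subseteq>P. card Q = n \<and> card (orders enclosed Q) \<le> card (orders enclosed P)"
  using assms
proof (induction "card P - n" arbitrary: P)
  case 0
  then show ?case by (intro exI[of _ P]) auto
next
  case (Suc l)
  obtain w :: 'n where "w \<noteq> 0" using nonzero_Basis nonempty_Basis by blast
  have "P \<noteq> {}" using Suc by auto
  then have "Max (inner w ` P) \<in> inner w ` P" using Suc.prems by (intro Max_in) auto
  then obtain p where p: "p \<in> P" "inner w p = Max (inner w ` P)" by auto
  have "inner w q \<le> inner w p" if "q \<in> P" for q
    using that Suc.prems p(2) by simp
  then have *: "card (orders enclosed (P - {p})) \<le> card (orders enclosed P)"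
    using p(1) \<open>w \<noteq> 0\<close> by (intro card_orders_remove_le maximal_not_surrounded) auto
  have "l = card (P - {p}) - n" "finite (P - {p})" "n \<le> card (P - {p})"
    using Suc.hyps(2) Suc.prems p(1) by auto
  from Suc.hyps(1)[OF this] obtain Q where "Q \<subseteq> P - {p}" "card Q = n"
    "card (orders enclosed Q) \<le> card (orders enclosed (P - {p}))" by blast
  then show ?case using * by (intro exI[of _ Q]) auto
qed

text \<open>An extreme point is not interior to the hull, and omitting that point from the
  generators only shrinks the interior.\<close>

lemma peeling_sequences_subset_orders: "peeling_sequences P \<subseteq> orders enclosed P"
proof -
  have "avoids enclosed ps"
    if "\<forall>i < length ps. (ps ! i) extreme_point_of (convex hull (set (drop i ps)))"
    for ps :: "(real ^ 'd) list"
    using that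
  proof (induction ps)
    case (Cons p ps)
    have "p extreme_point_of (convex hull (insert p (set ps)))" using Cons.prems[THEN spec, of 0] by simp
    then have "p \<notin> interior (convex hull (insert p (set ps)))" by (rule extreme_point_not_in_interior)
    then have "\<not> enclosed p (set ps)"
      using surrounded_mono[of "\<lambda>x. x" p "set ps" "insert p (set ps)"] by (auto simp: surrounded_def)
    moreover have "avoids enclosed ps"
    proof (intro Cons.IH allI impI)
      fix i assume "i < length ps"
      then show "(ps ! i) extreme_point_of (convex hull (set (drop i ps)))"
        using Cons.prems[THEN spec, of "Suc i"] by simp
    qed
    ultimately show ?case by simp
  qed simp
  then show ?thesis by (auto simp: peeling_sequences_def orders_def)
qed

theorem corollary2:
  fixes n :: nat
  assumes "CARD('d::finite) \<ge> 2"
  shows "\<exists>P :: (real ^ 'd) set. finite P \<and> card P = n \<and> general_position P \<and>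
           card (peeling_sequences P) \<le> (CARD('d) + 1) ^ ((CARD('d) + 1)\<^sup>2 * n)"
proof (cases "n = 0")
  \<comment> \<open>For \<open>n = 0\<close> the estimate \<open>k ^ j \<le> k * n\<close> used in
    the other case would fail.\<close>
  case True
  have "peeling_sequences {} \<subseteq> {[] :: (real ^ 'd) list}" by (auto simp: peeling_sequences_def)
  then have "card (peeling_sequences ({} :: (real ^ 'd) set)) \<le> 1"
    using card_mono[of "{[] :: (real ^ 'd) list}"] by simp
  then show ?thesis using True by (intro exI[of _ "{}"]) (auto simp: general_position_def)
next
  case False
  define k where "k = CARD('d) + 1"
  have "k \<ge> 2" by (simp add: k_def Suc_le_eq)
  define j where "j = (LEAST j. n \<le> k ^ j)"
  have "n < 2 ^ n" by (rule less_exp)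
  also have "2 ^ n \<le> k ^ n" using \<open>k \<ge> 2\<close> by (intro power_mono) auto
  finally have ex: "n \<le> k ^ n" by simp
  have le: "n \<le> k ^ j" unfolding j_def by (rule LeastI[of "\<lambda>j. n \<le> k ^ j", OF ex])
  \<comment> \<open>If \<open>j\<close> is positive, the previous power lies below \<open>n\<close>.
    The factor \<open>k\<close> lost here accounts for the square in the final exponent.\<close>
  have up: "k ^ j \<le> k * n"
  proof (cases j)
    case 0
    then show ?thesis using False \<open>k \<ge> 2\<close> by simp
  next
    case (Suc i)
    then have "\<not> n \<le> k ^ i" using not_less_Least[of i "\<lambda>j. n \<le> k ^ j"] by (simp add: j_def)
    then show ?thesis using Suc by simp
  qed
  obtain w :: "real ^ 'd" where "w \<noteq> 0" using nonzero_Basis nonempty_Basis by blast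
  obtain P :: "(real ^ 'd) set" where P: "finite P" "card P = k ^ j" "general_position P"
    "card (orders enclosed P) \<le> k ^ (k * k ^ j)"
    using few_peelings_power[OF \<open>w \<noteq> 0\<close>, of j] unfolding k_def by blast
  obtain Q where Q: "Q \<subseteq> P" "card Q = n"
    "card (orders enclosed Q) \<le> card (orders enclosed P)"
    using few_peelings_subset[of P n] P le by auto
  have "card (peeling_sequences Q) \<le> card (orders enclosed Q)"
    by (intro card_mono finite_orders peeling_sequences_subset_orders)
  also note Q(3)
  also note P(4)
  also have "k ^ (k * k ^ j) \<le> k ^ (k\<^sup>2 * n)"
    using up \<open>k \<ge> 2\<close> by (intro power_increasing) (auto simp: power2_eq_square)
  finally have "card (peeling_sequences Q) \<le> k ^ (k\<^sup>2 * n)" .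
  moreover have "general_position Q" using P(3) Q(1) unfolding general_position_def by blast
  ultimately show ?thesis using Q P(1) finite_subset unfolding k_def by blast
qed

end
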